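(* Let $V$ be an $N$-dimensional vector space over the finite field $\mathbb{F}_q$, and let $\mathcal{C}\subseteq\mathcal{L}(V)$ be a code with minimum distance $D(\mathcal{C})$ under the $\mathfrak{N}$-induced distance $d_{\mathfrak{N}}$. Suppose that $S\in\mathcal{C}$ is transmitted over an atomic operator channel, and that the received subspace is $$U=\bigvee_{A_i\in\mathfrak{a}_S'}A_i\;\vee\;\bigvee_{j=1}^{t}B_j,\qquad U\subseteq V,$$ where $\mathfrak{a}_S'$ denotes the surviving atoms of $S$ and the inserted atoms $B_1,\dots,B_t$ satisfy $B_j\cap S=\{0\}$ for all $j$. Let $S'=S\cap U$. Then: 1. The total atomic distortion satisfies $d_{\mathfrak{N}}(U,S)=d_{\mathfrak{N}}(S,S')+d_{\mathfrak{N}}(U,S')=\epsilon(S,S')+\iota(U,S')$. 2. If $2\,d_{\mathfrak{N}}(U,S)<D(\mathcal{C})$, then $S$ is the unique codeword in $\mathcal{C}$ minimizing the distance $d_{\mathfrak{N}}(U,\cdot)$ to $U$, and the minimum-distance decoder recovers $S$.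
   Context: $\mathcal{L}(V)$ is the lattice of subspaces of $V$; the join $\vee$ is the sum of subspaces. An atom is a one-dimensional subspace of $V$. For a subspace $S\subseteq V$, a set of atoms $\{A_1,\dots,A_k\}$ is an atomic decomposition of $S$ if $A_1+\cdots+A_k=S$. It is minimal if no proper subset of it is an atomic decomposition of $S$. $\mathfrak{N}(S)$ denotes the number of minimal atomic decompositions of $S$. The $\mathfrak{N}$-induced distance is $d_{\mathfrak{N}}(S,T)=\mathfrak{N}(S)+\mathfrak{N}(T)-2\,\mathfrak{N}(S\cap T)$. A code is a nonempty collection $\mathcal{C}\subseteq\mathcal{L}(V)$, with minimum distance $D(\mathcal{C})=\min\{d_{\mathfrak{N}}(X,Y): X,Y\in\mathcal{C},\ X\ne Y\}$. Atomic operator channel: the transmitted subspace $S$ is given by a redundant atomic decomposition $\mathfrak{a}_S=\{A_1,\dots,A_k\}$ of $S$ (each $A_i$ a one-dimensional subspace of $S$, $S=\bigvee_{i=1}^k A_i$, $k>\dim S$). The output is a subspace $U=\bigvee_{A_i\in\mathfrak{a}_S'}A_i\vee\bigvee_{j=1}^tB_j$, where $\mathfrak{a}_S'\subseteq\mathfrak{a}_S$ is the collection of surviving atoms and $B_1,\dots,B_t$ are one-dimensional subspaces of $V$ with $B_j\cap S=\{0\}$ for all $j$. The receiver observes only $U$. The atomic erasure cost is $\epsilon(S,S'):=d_{\mathfrak{N}}(S,S')$, the atomic insertion cost is $\iota(U,S'):=d_{\mathfrak{N}}(U,S')$, and the total atomic error (distortion) is $d_{\mathfrak{N}}(U,S)$.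 A minimum-distance decoder is one which, upon receiving $U$, outputs a codeword $\widehat{S}\in\mathcal{C}$ with $d_{\mathfrak{N}}(U,\widehat{S})=\min_{T\in\mathcal{C}}d_{\mathfrak{N}}(U,T)$. *)

theory Defs
  imports Complex_Main "HOL-Library.Set_Algebras" "HOL-Library.Extended_Real"
begin

text \<open>
  The ambient space is the whole type of vectors. Sums of subspaces are the elementwise sums of
  sets from \<^theory>\<open>HOL-Library.Set_Algebras\<close>; in particular the empty sum is the zero subspace.
\<close>

definition atom ::
    "('a::field \<Rightarrow> 'b::ab_group_add \<Rightarrow> 'b) \<Rightarrow> 'b set \<Rightarrow> bool" where
  "atom scale A \<longleftrightarrow> module.subspace scale A \<and> vector_space.dim scale A = 1"

text \<open>The empty set is an atomic decomposition of the zero subspace.\<close>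

definition atomic_decomposition ::
    "('a::field \<Rightarrow> 'b::ab_group_add \<Rightarrow> 'b) \<Rightarrow> 'b set set \<Rightarrow> 'b set \<Rightarrow> bool" where
  "atomic_decomposition scale \<AA> S \<longleftrightarrow> finite \<AA> \<and> (\<forall>A\<in>\<AA>. atom scale A) \<and> (\<Sum>A\<in>\<AA>. A) = S"

definition minimal_atomic_decomposition ::
    "('a::field \<Rightarrow> 'b::ab_group_add \<Rightarrow> 'b) \<Rightarrow> 'b set set \<Rightarrow> 'b set \<Rightarrow> bool" where
  "minimal_atomic_decomposition scale \<AA> S \<longleftrightarrow>
     atomic_decomposition scale \<AA> S \<and> (\<forall>\<BB>. \<BB> \<subset> \<AA> \<longrightarrow> \<not> atomic_decomposition scale \<BB> S)"

definition redundant_atomic_decomposition ::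
    "('a::field \<Rightarrow> 'b::ab_group_add \<Rightarrow> 'b) \<Rightarrow> 'b set set \<Rightarrow> 'b set \<Rightarrow> bool" where
  "redundant_atomic_decomposition scale \<AA> S \<longleftrightarrow>
     atomic_decomposition scale \<AA> S \<and> card \<AA> > vector_space.dim scale S"

definition num_min_decomp ::
    "('a::field \<Rightarrow> 'b::ab_group_add \<Rightarrow> 'b) \<Rightarrow> 'b set \<Rightarrow> nat" where
  "num_min_decomp scale S = card {\<AA>. minimal_atomic_decomposition scale \<AA> S}"

definition dist_N ::
    "('a::field \<Rightarrow> 'b::ab_group_add \<Rightarrow> 'b) \<Rightarrow> 'b set \<Rightarrow> 'b set \<Rightarrow> int" where
  "dist_N scale S T =
     int (num_min_decomp scale S) + int (num_min_decomp scale T) - 2 * int (num_min_decomp scale (S \<inter> T))"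

definition erasure_cost ::
    "('a::field \<Rightarrow> 'b::ab_group_add \<Rightarrow> 'b) \<Rightarrow> 'b set \<Rightarrow> 'b set \<Rightarrow> int" where
  "erasure_cost scale S S' = dist_N scale S S'"

definition insertion_cost ::
    "('a::field \<Rightarrow> 'b::ab_group_add \<Rightarrow> 'b) \<Rightarrow> 'b set \<Rightarrow> 'b set \<Rightarrow> int" where
  "insertion_cost scale U S' = dist_N scale U S'"

definition subspace_code ::
    "('a::field \<Rightarrow> 'b::ab_group_add \<Rightarrow> 'b) \<Rightarrow> 'b set set \<Rightarrow> bool" where
  "subspace_code scale \<C> \<longleftrightarrow> \<C> \<noteq> {} \<and> \<C> \<subseteq> {S. module.subspace scale S}"

text \<open>
  Over a finite space the infimum is a minimum as soon as the code has two codewords; the minimum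
  distance of a code with a single codeword is infinite.
\<close>

definition min_distance ::
    "('a::field \<Rightarrow> 'b::ab_group_add \<Rightarrow> 'b) \<Rightarrow> 'b set set \<Rightarrow> ereal" where
  "min_distance scale \<C> =
     (INF (X, Y) \<in> {(X, Y). X \<in> \<C> \<and> Y \<in> \<C> \<and> X \<noteq> Y}. ereal (real_of_int (dist_N scale X Y)))"

definition min_distance_decoder ::
    "('a::field \<Rightarrow> 'b::ab_group_add \<Rightarrow> 'b) \<Rightarrow> 'b set set \<Rightarrow> ('b set \<Rightarrow> 'b set) \<Rightarrow> bool" where
  "min_distance_decoder scale \<C> dec \<longleftrightarrow>
     (\<forall>U. module.subspace scale U \<longrightarrow>
        dec U \<in> \<C> \<and> dist_N scale U (dec U) = (MIN T\<in>\<C>. dist_N scale U T))"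

text \<open>
  \<open>\<AA>\<close> is the decomposition by which \<open>S\<close> is sent, \<open>\<AA>'\<close> the surviving atoms, \<open>B 1, \<dots>, B t\<close> the
  inserted atoms, and \<open>U\<close> the subspace received.
\<close>

definition atomic_operator_channel ::
    "('a::field \<Rightarrow> 'b::ab_group_add \<Rightarrow> 'b) \<Rightarrow> 'b set \<Rightarrow> 'b set set \<Rightarrow>
      'b set set \<Rightarrow> nat \<Rightarrow> (nat \<Rightarrow> 'b set) \<Rightarrow> 'b set \<Rightarrow> bool" where
  "atomic_operator_channel scale S \<AA> \<AA>' t B U \<longleftrightarrow>
     redundant_atomic_decomposition scale \<AA> S \<and> \<AA>' \<subseteq> \<AA> \<and>
     (\<forall>j\<in>{1..t}. atom scale (B j) \<and> B j \<inter> S = {0}) \<and>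
     U = (\<Sum>A\<in>\<AA>'. A) + (\<Sum>j = 1..t. B j)"

end

theory Submission
  imports Defs
begin

text \<open>
  Write \<open>N\<close> for the number of minimal atomic decompositions. The splitting of the distortion is
  arithmetic: \<open>S \<inter> U\<close> lies in both \<open>S\<close> and \<open>U\<close>, so the terms \<open>N (S \<inter> U)\<close> add up as required. Unique
  decoding is the usual consequence of the triangle inequality
  \<open>d S T \<le> d U S + d U T\<close>, which unfolds to
  \<open>N (S \<inter> U) + N (T \<inter> U) \<le> N U + N (S \<inter> T)\<close>. This follows from

    \<^item> supermodularity in the form \<open>N X + N Y \<le> N U + N (X \<inter> Y)\<close> for subspaces \<open>X\<close>, \<open>Y\<close> of \<open>U\<close>
      (\<open>num_min_decomp_supermodular\<close>), applied to \<open>X = S \<inter> U\<close> and \<open>Y = T \<inter> U\<close>, and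

    \<^item> monotonicity of \<open>N\<close>, which is its special case \<open>X = Y\<close>.

  Supermodularity has a bijective proof that needs no formula for \<open>N\<close>. A minimal atomic decomposition
  of \<open>X\<close> is a basis of \<open>X\<close> up to scaling of its vectors, that is, a family of \<open>dim X\<close> atoms that span
  \<open>X\<close> (\<open>minimal_atomic_decomposition_iff\<close>). Choose atoms \<open>P\<close> that extend \<open>X \<inter> Y\<close> to \<open>X\<close>, atoms \<open>Q\<close>
  that extend \<open>X \<inter> Y\<close> to \<open>Y\<close>, and atoms \<open>R\<close> that extend \<open>X + Y\<close> to \<open>U\<close>. Adding \<open>Q \<union> R\<close> injects the
  minimal decompositions of \<open>X\<close> into those of \<open>U\<close>, and adding \<open>P \<union> R\<close> does the same for those of \<open>Y\<close>.
  A decomposition of \<open>U\<close> in both images contains \<open>P \<union> Q \<union> R\<close>, and removing these atoms leaves a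
  minimal decomposition of \<open>X \<inter> Y\<close>. So the two images together have at most \<open>N U\<close> elements and
  overlap in at most \<open>N (X \<inter> Y)\<close>.
\<close>

section \<open>Sums and spans of atoms\<close>

context finite_dimensional_vector_space
begin

lemma subspace_atom: "atom scale A \<Longrightarrow> subspace A"
  by (simp add: atom_def)

lemma atom_span_singleton:
  assumes "x \<noteq> 0"
  shows "atom scale (span {x})"
  using assms by (simp add: atom_def)

lemma atom_eq_span_singleton:
  assumes "atom scale A"
  obtains x where "A = span {x}"
proof -
  have A: "subspace A" "dim A = 1"
    using assms by (auto simp: atom_def)
  obtain B where B: "B \<subseteq> A" "independent B" "A \<subseteq> span B" "card B = dim A"
    by (rule basis_exists)
  then obtain x where "B = {x}"
    using A by (auto simp: card_1_singleton_iff)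
  moreover have "span B = A"
    using B A by (intro span_subspace)
  ultimately show ?thesis using that by blast
qed

lemma sum_subspaces_eq_span:
  assumes "finite I" "\<And>i. i \<in> I \<Longrightarrow> subspace (f i)"
  shows "(\<Sum>i\<in>I. f i) = span (\<Union>i\<in>I. f i)"
  using assms
proof (induction I rule: finite_induct)
  case empty
  then show ?case by simp
next
  case (insert i I)
  have "span (\<Union>j\<in>insert i I. f j) = {x + y |x y. x \<in> f i \<and> y \<in> span (\<Union>j\<in>I. f j)}"
    using span_Un[of "f i"] span_eq_iff[THEN iffD2, OF insert.prems[of i]] by simp
  also have "\<dots> = f i + (\<Sum>j\<in>I. f j)"
    using insert by (auto simp: set_plus_def)
  finally show ?case using insert.hyps by simp
qed

lemma subspace_sum_subspaces:
  assumes "finite I" "\<And>i. i \<in> I \<Longrightarrow> subspace (f i)"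
  shows "subspace (\<Sum>i\<in>I. f i)"
  using assms by (simp add: sum_subspaces_eq_span)

lemma subspace_set_plus:
  assumes "subspace S" "subspace T"
  shows "subspace (S + T)"
proof -
  have "S + T = {x + y |x y. x \<in> S \<and> y \<in> T}"
    by (auto simp: set_plus_def)
  then show ?thesis using subspace_sums[OF assms] by simp
qed

lemma span_Un_eq_set_plus:
  assumes "subspace S" "subspace T"
  shows "span (S \<union> T) = S + T"
proof -
  have "span (S \<union> T) = {x + y |x y. x \<in> S \<and> y \<in> T}"
    using span_Un[of S T] assms[THEN span_eq_iff[THEN iffD2]] by simp
  then show ?thesis by (auto simp: set_plus_def)
qed

lemma span_Un_span: "span (span S \<union> T) = span (S \<union> T)"
  by (simp add: span_Un span_span)

lemma dim_Un_atoms_le: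
  assumes "finite \<AA>" "\<forall>A\<in>\<AA>. atom scale A"
  shows "dim (V \<union> \<Union>\<AA>) \<le> dim V + card \<AA>"
  using assms
proof (induction \<AA> rule: finite_induct)
  case empty
  then show ?case by simp
next
  case (insert A \<AA>)
  then obtain x where "A = span {x}"
    using atom_eq_span_singleton by (metis insertI1)
  then have "span (V \<union> \<Union>(insert A \<AA>)) = span (insert x (V \<union> \<Union>\<AA>))"
    using span_Un_span[of "{x}" "V \<union> \<Union>\<AA>"] by (simp add: Un_left_commute)
  then have "dim (V \<union> \<Union>(insert A \<AA>)) = dim (insert x (V \<union> \<Union>\<AA>))"
    by (rule span_eq_dim)
  also have "\<dots> \<le> dim (V \<union> \<Union>\<AA>) + 1"
    by (simp add: dim_insert)
  finally show ?case using insert by simp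
qed

lemma dim_span_atoms_le:
  assumes "finite \<AA>" "\<forall>A\<in>\<AA>. atom scale A"
  shows "dim (\<Union>\<AA>) \<le> card \<AA>"
  using dim_Un_atoms_le[OF assms, of "{}"] by simp

section \<open>Minimal decompositions as bases up to scaling\<close>

lemma atomic_decomposition_iff:
  "atomic_decomposition scale \<AA> S \<longleftrightarrow> finite \<AA> \<and> (\<forall>A\<in>\<AA>. atom scale A) \<and> span (\<Union>\<AA>) = S"
  unfolding atomic_decomposition_def
  using sum_subspaces_eq_span[of \<AA> "\<lambda>A. A"] subspace_atom by auto

text \<open>
  Choosing a nonzero vector in every atom of a decomposition gives a spanning set, and the atoms of
  a basis contained in it already form a decomposition; minimality leaves no other atoms. Conversely,
  fewer than \<open>dim S\<close> atoms cannot span \<open>S\<close>.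
\<close>

lemma minimal_atomic_decomposition_iff:
  "minimal_atomic_decomposition scale \<AA> S \<longleftrightarrow>
     finite \<AA> \<and> (\<forall>A\<in>\<AA>. atom scale A) \<and> span (\<Union>\<AA>) = S \<and> card \<AA> = dim S"
    (is "?min \<longleftrightarrow> ?basis")
proof
  assume min: ?min
  then have \<AA>: "finite \<AA>" "\<forall>A\<in>\<AA>. atom scale A" "span (\<Union>\<AA>) = S"
    by (auto simp: minimal_atomic_decomposition_def atomic_decomposition_iff)
  have "\<forall>A\<in>\<AA>. \<exists>x. A = span {x}"
    using \<AA>(2) atom_eq_span_singleton by blast
  then obtain v where v: "\<And>A. A \<in> \<AA> \<Longrightarrow> A = span {v A}"
    by metis
  have v_in: "v A \<in> A" if "A \<in> \<AA>" for A
    using v[OF that] span_base[of "v A" "{v A}"] by simp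
  obtain B where B: "B \<subseteq> v ` \<AA>" "independent B" "v ` \<AA> \<subseteq> span B"
    using maximal_independent_subset by blast
  obtain \<BB> where \<BB>: "\<BB> \<subseteq> \<AA>" "inj_on v \<BB>" "B = v ` \<BB>"
    using B(1) subset_image_inj by metis
  have "A \<subseteq> span (\<Union>\<BB>)" if "A \<in> \<AA>" for A
  proof -
    have "v A \<in> span B" using B(3) that by blast
    moreover have "B \<subseteq> \<Union>\<BB>"
      using \<BB>(1,3) v_in by blast
    ultimately have "v A \<in> span (\<Union>\<BB>)"
      using span_mono by blast
    then have "span {v A} \<subseteq> span (\<Union>\<BB>)"
      by (intro span_minimal) auto
    then show ?thesis using v[OF that] by simp
  qed
  then have "span (\<Union>\<AA>) \<subseteq> span (\<Union>\<BB>)"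
    by (intro span_minimal) auto
  moreover have "span (\<Union>\<BB>) \<subseteq> span (\<Union>\<AA>)"
    using \<BB>(1) by (intro span_mono) auto
  ultimately have "atomic_decomposition scale \<BB> S"
    using \<AA> \<BB>(1) by (auto simp: atomic_decomposition_iff intro: finite_subset)
  then have "\<BB> = \<AA>"
    using min \<BB>(1) unfolding minimal_atomic_decomposition_def by blast
  then have "card \<AA> = card B"
    using \<BB> by (simp add: card_image)
  also have "\<dots> = dim B"
    using B(2) by (simp add: dim_eq_card_independent)
  also have "\<dots> \<le> dim S"
  proof (intro dim_subset)
    have "B \<subseteq> \<Union>\<AA>" using B(1) v_in by blast
    then show "B \<subseteq> S" using \<AA>(3) span_superset by blast
  qed
  finally have "card \<AA> \<le> dim S" .
  moreover have "dim S \<le> card \<AA>"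
    using dim_span_atoms_le[OF \<AA>(1,2)] dim_span[of "\<Union>\<AA>"] \<AA>(3) by simp
  ultimately show ?basis using \<AA> by simp
next
  assume basis: ?basis
  have "\<not> atomic_decomposition scale \<BB> S" if "\<BB> \<subset> \<AA>" for \<BB>
  proof
    assume "atomic_decomposition scale \<BB> S"
    then have "dim S \<le> card \<BB>"
      using dim_span_atoms_le[of \<BB>] dim_span[of "\<Union>\<BB>"] by (simp add: atomic_decomposition_iff)
    moreover have "card \<BB> < card \<AA>"
      using that basis by (intro psubset_card_mono) auto
    ultimately show False using basis by simp
  qed
  then show ?min
    using basis by (simp add: minimal_atomic_decomposition_def atomic_decomposition_iff)
qed

section \<open>Extending and restricting minimal decompositions\<close>

text \<open>
  \<open>P\<close> is a basis, up to scaling, of a complement of \<open>V\<close> in \<open>W\<close>. The inequality suffices because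
  \<open>dim W \<le> dim V + card P\<close> follows from the other conditions.
\<close>

definition complementing_atoms :: "'b set \<Rightarrow> 'b set \<Rightarrow> 'b set set \<Rightarrow> bool" where
  "complementing_atoms V W P \<longleftrightarrow>
     finite P \<and> (\<forall>A\<in>P. atom scale A) \<and> span (V \<union> \<Union>P) = W \<and> card P + dim V \<le> dim W"

lemma card_complementing_atoms:
  assumes "complementing_atoms V W P"
  shows "card P + dim V = dim W"
  using assms dim_Un_atoms_le[of P V] dim_span[of "V \<union> \<Union>P"]
  unfolding complementing_atoms_def by auto

lemma complementing_atoms_exist:
  assumes "subspace V" "subspace W" "V \<subseteq> W"
  obtains P where "complementing_atoms V W P"
proof -
  obtain B where B: "B \<subseteq> V" "independent B" "V \<subseteq> span B" "card B = dim V"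
    by (rule basis_exists)
  obtain C where C: "B \<subseteq> C" "C \<subseteq> W" "independent C" "W \<subseteq> span C"
    using maximal_independent_subset_extend[OF subset_trans[OF B(1) assms(3)] B(2)] .
  let ?P = "(\<lambda>x. span {x}) ` (C - B)"
  have fin: "finite C" using C(3) by (rule finiteI_independent)
  have "x \<noteq> 0" if "x \<in> C" for x
    using C(3) that dependent_zero[of C] by auto
  then have atoms: "\<forall>A\<in>?P. atom scale A"
    using atom_span_singleton by blast
  have "span {x} \<subseteq> W" if "x \<in> C" for x
    using C(2) that by (intro span_minimal[OF _ assms(2)]) auto
  then have "V \<union> \<Union>?P \<subseteq> W"
    using assms(3) by blast
  moreover have "C \<subseteq> V \<union> \<Union>?P"
    using B(1) span_superset[of "{_}"] by blast
  then have "W \<subseteq> span (V \<union> \<Union>?P)"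
    using C(4) span_mono[of C "V \<union> \<Union>?P"] by blast
  ultimately have "span (V \<union> \<Union>?P) = W"
    using assms(2) by (intro span_subspace)
  moreover have "card ?P + dim V \<le> dim W"
  proof -
    have "card ?P \<le> card (C - B)" using fin by (simp add: card_image_le)
    moreover have "card (C - B) + card B = card C"
      using fin C(1) by (simp add: card_Diff_subset card_mono finite_subset)
    moreover have "card C = dim W"
      using C by (intro basis_card_eq_dim)
    ultimately show ?thesis using B(4) by simp
  qed
  ultimately have "complementing_atoms V W ?P"
    using fin atoms by (simp add: complementing_atoms_def)
  then show ?thesis by (rule that)
qed

lemma complementing_atoms_trans:
  assumes "complementing_atoms V W P" "complementing_atoms W Z Q"
  shows "complementing_atoms V Z (P \<union> Q)"
proof -
  have "span (V \<union> \<Union>(P \<union> Q)) = span (W \<union> \<Union>Q)"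
    using assms(1) span_Un_span[of "V \<union> \<Union>P" "\<Union>Q"]
    by (simp add: complementing_atoms_def Un_assoc)
  moreover have "card (P \<union> Q) \<le> card P + card Q"
    by (rule card_Un_le)
  ultimately show ?thesis
    using assms by (auto simp: complementing_atoms_def)
qed

text \<open>The isomorphism between \<open>Y\<close> modulo \<open>X \<inter> Y\<close> and \<open>X + Y\<close> modulo \<open>X\<close>, in terms of bases.\<close>

lemma complementing_atoms_sum:
  assumes "subspace X" "subspace Y" "complementing_atoms (X \<inter> Y) Y Q"
  shows "complementing_atoms X (X + Y) Q"
proof -
  have "span (X \<union> \<Union>Q) = span (X \<union> (X \<inter> Y \<union> \<Union>Q))"
    by (simp add: Un_assoc[symmetric] Un_absorb2)
  also have "\<dots> = span (X \<union> span (X \<inter> Y \<union> \<Union>Q))"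
    using span_Un_span[of "X \<inter> Y \<union> \<Union>Q" X] by (simp add: Un_commute)
  also have "\<dots> = X + Y"
    using assms by (simp add: complementing_atoms_def span_Un_eq_set_plus)
  finally have "span (X \<union> \<Union>Q) = X + Y" .
  moreover have "X + Y = {x + y |x y. x \<in> X \<and> y \<in> Y}"
    by (auto simp: set_plus_def)
  then have "dim (X + Y) + dim (X \<inter> Y) = dim X + dim Y"
    using dim_sums_Int[OF assms(1,2)] by simp
  ultimately show ?thesis
    using assms(3) by (simp add: complementing_atoms_def)
qed

text \<open>
  The union spans \<open>W\<close> and has at most \<open>dim V + card P = dim W\<close> members, so both bounds are attained
  and no atom is counted twice.
\<close>

lemma minimal_atomic_decomposition_Un:
  assumes "minimal_atomic_decomposition scale \<AA> V" "complementing_atoms V W P"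
  shows "minimal_atomic_decomposition scale (\<AA> \<union> P) W" and "\<AA> \<inter> P = {}"
proof -
  have fin: "finite \<AA>" "finite P"
    and atoms: "\<forall>A\<in>\<AA> \<union> P. atom scale A"
    and card: "card \<AA> = dim V" "card P + dim V \<le> dim W"
    and span: "span (\<Union>\<AA>) = V" "span (V \<union> \<Union>P) = W"
    using assms by (auto simp: minimal_atomic_decomposition_iff complementing_atoms_def)
  have span_Un: "span (\<Union>(\<AA> \<union> P)) = W"
    using span span_Un_span[of "\<Union>\<AA>" "\<Union>P"] by simp
  have "dim W \<le> card (\<AA> \<union> P)"
    using dim_span_atoms_le[of "\<AA> \<union> P"] dim_span[of "\<Union>(\<AA> \<union> P)"] fin atoms
    unfolding span_Un by simp
  moreover have "card (\<AA> \<union> P) + card (\<AA> \<inter> P) = card \<AA> + card P"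
    using card_Un_Int[OF fin] by simp
  ultimately have eqs: "card (\<AA> \<union> P) = dim W" "card (\<AA> \<inter> P) = 0"
    using card by simp_all
  then show "minimal_atomic_decomposition scale (\<AA> \<union> P) W"
    using fin atoms span_Un by (simp add: minimal_atomic_decomposition_iff)
  show "\<AA> \<inter> P = {}"
    using eqs(2) fin by simp
qed

text \<open>
  Removing \<open>card P\<close> atoms lowers the dimension of the span by at most \<open>card P\<close>, so what remains spans
  a subspace of \<open>V\<close> of full dimension \<open>dim V\<close>.
\<close>

lemma minimal_atomic_decomposition_Diff:
  assumes "minimal_atomic_decomposition scale \<AA> W" "complementing_atoms V W P"
    and "P \<subseteq> \<AA>" "subspace V" "\<Union>(\<AA> - P) \<subseteq> V"
  shows "minimal_atomic_decomposition scale (\<AA> - P) V"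
proof -
  have fin: "finite \<AA>" "finite P"
    and atoms: "\<forall>A\<in>\<AA>. atom scale A"
    and span: "span (\<Union>\<AA>) = W"
    and card: "card \<AA> = dim W"
    using assms(1,2) by (auto simp: minimal_atomic_decomposition_iff complementing_atoms_def)
  have card_P: "card P + dim V = dim W"
    using assms(2) by (rule card_complementing_atoms)
  have "\<Union>\<AA> = \<Union>(\<AA> - P) \<union> \<Union>P"
    using assms(3) by auto
  then have "dim (\<Union>\<AA>) \<le> dim (\<Union>(\<AA> - P)) + card P"
    using dim_Un_atoms_le[of P "\<Union>(\<AA> - P)"] fin atoms assms(3) by (metis subsetD)
  then have "dim W \<le> dim (\<Union>(\<AA> - P)) + card P"
    using dim_span[of "\<Union>\<AA>"] unfolding span by simp
  then have "dim V \<le> dim (span (\<Union>(\<AA> - P)))"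
    using card_P by simp
  moreover have "span (\<Union>(\<AA> - P)) \<subseteq> V"
    using assms(4,5) by (intro span_minimal)
  ultimately have "span (\<Union>(\<AA> - P)) = V"
    using assms(4) by (intro subspace_dim_equal) auto
  moreover have "card (\<AA> - P) = dim V"
    using card card_P fin assms(3) by (simp add: card_Diff_subset)
  ultimately show ?thesis
    using fin atoms by (simp add: minimal_atomic_decomposition_iff)
qed

section \<open>Supermodularity and the triangle inequality\<close>

lemma finite_span_finite_field:
  assumes "finite (UNIV :: 'a set)" "finite B"
  shows "finite (span B)"
  using assms(2)
proof (induction B rule: finite_induct)
  case empty
  then show ?case by simp
next
  case (insert b B)
  have "span (insert b B) \<subseteq> (\<lambda>(k, y). scale k b + y) ` (UNIV \<times> span B)"
  proof
    fix x assume "x \<in> span (insert b B)"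
    then obtain k where "x - scale k b \<in> span B"
      by (auto simp: span_insert)
    then show "x \<in> (\<lambda>(k, y). scale k b + y) ` (UNIV \<times> span B)"
      by (intro image_eqI[of _ _ "(k, x - scale k b)"]) auto
  qed
  then show ?case
    using insert.IH assms(1) by (meson finite_SigmaI finite_imageI finite_subset)
qed

lemma finite_UNIV_finite_field:
  assumes "finite (UNIV :: 'a set)"
  shows "finite (UNIV :: 'b set)"
  using finite_span_finite_field[OF assms finite_Basis] by (simp add: span_Basis)

lemma finite_minimal_atomic_decompositions:
  assumes "finite (UNIV :: 'a set)"
  shows "finite {\<AA>. minimal_atomic_decomposition scale \<AA> S}"
proof (rule finite_subset[OF subset_UNIV])
  show "finite (UNIV :: 'b set set set)"
    using finite_UNIV_finite_field[OF assms] by (simp add: Finite_Set.finite_set)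
qed

text \<open>
  The minimal decompositions of \<open>X\<close> and of \<open>Y\<close> are embedded into those of \<open>U\<close> by adding fixed atoms.
  Those that extend \<open>X\<close> to \<open>X + Y\<close> are chosen inside \<open>Y\<close>, and vice versa, and those that extend
  \<open>X + Y\<close> to \<open>U\<close> are the same for both. Hence a decomposition in both images differs from the chosen
  atoms only by atoms in \<open>X \<inter> Y\<close>.
\<close>

lemma num_min_decomp_supermodular:
  assumes "finite (UNIV :: 'a set)"
    and "subspace X" "subspace Y" "subspace U" "X \<subseteq> U" "Y \<subseteq> U"
  shows "num_min_decomp scale X + num_min_decomp scale Y
           \<le> num_min_decomp scale U + num_min_decomp scale (X \<inter> Y)"
proof -
  let ?\<M> = "\<lambda>S. {\<AA>. minimal_atomic_decomposition scale \<AA> S}"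
  have fin: "finite (?\<M> S)" for S
    using finite_minimal_atomic_decompositions[OF assms(1)] .
  have XY: "subspace (X \<inter> Y)" "subspace (X + Y)"
    using assms(2,3) by (auto intro: subspace_inter subspace_set_plus)
  have "X + Y \<subseteq> U"
    using assms(5,6) subspace_add[OF assms(4)] unfolding set_plus_def by blast
  obtain P where P: "complementing_atoms (X \<inter> Y) X P"
    using complementing_atoms_exist[OF XY(1) assms(2)] by auto
  obtain Q where Q: "complementing_atoms (X \<inter> Y) Y Q"
    using complementing_atoms_exist[OF XY(1) assms(3)] by auto
  obtain R where R: "complementing_atoms (X + Y) U R"
    using complementing_atoms_exist[OF XY(2) assms(4) \<open>X + Y \<subseteq> U\<close>] .
  have QR: "complementing_atoms X U (Q \<union> R)"
    using complementing_atoms_trans[OF complementing_atoms_sum[OF assms(2,3) Q] R] .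
  have "complementing_atoms Y (X + Y) P"
    using complementing_atoms_sum[of Y X P] assms(2,3) P by (simp add: Int_commute add.commute)
  then have PR: "complementing_atoms Y U (P \<union> R)"
    using complementing_atoms_trans R by blast
  have PQR: "complementing_atoms (X \<inter> Y) U (P \<union> (Q \<union> R))"
    using complementing_atoms_trans[OF P QR] .
  let ?f = "\<lambda>\<AA>. \<AA> \<union> (Q \<union> R)" and ?g = "\<lambda>\<BB>. \<BB> \<union> (P \<union> R)"
  have inj_f: "inj_on ?f (?\<M> X)"
    by (rule inj_onI) (use minimal_atomic_decomposition_Un(2)[OF _ QR] in blast)
  have inj_g: "inj_on ?g (?\<M> Y)"
    by (rule inj_onI) (use minimal_atomic_decomposition_Un(2)[OF _ PR] in blast)
  have "?f ` ?\<M> X \<union> ?g ` ?\<M> Y \<subseteq> ?\<M> U"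
    using minimal_atomic_decomposition_Un(1)[OF _ QR]
      minimal_atomic_decomposition_Un(1)[OF _ PR] by blast
  then have union: "card (?f ` ?\<M> X \<union> ?g ` ?\<M> Y) \<le> card (?\<M> U)"
    by (intro card_mono fin)
  let ?h = "\<lambda>\<CC>. \<CC> - (P \<union> (Q \<union> R))"
  have common: "P \<union> (Q \<union> R) \<subseteq> \<CC> \<and> ?h \<CC> \<in> ?\<M> (X \<inter> Y)"
    if \<CC>: "\<CC> \<in> ?f ` ?\<M> X \<inter> ?g ` ?\<M> Y" for \<CC>
  proof -
    obtain \<AA> where \<AA>: "minimal_atomic_decomposition scale \<AA> X" "\<CC> = \<AA> \<union> (Q \<union> R)"
      using \<CC> by blast
    obtain \<BB> where \<BB>: "minimal_atomic_decomposition scale \<BB> Y" "\<CC> = \<BB> \<union> (P \<union> R)"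
      using \<CC> by blast
    have sub: "P \<union> (Q \<union> R) \<subseteq> \<CC>" using \<AA>(2) \<BB>(2) by blast
    have "\<Union>\<AA> \<subseteq> X" "\<Union>\<BB> \<subseteq> Y"
      using \<AA>(1) \<BB>(1) span_superset[of "\<Union>\<AA>"] span_superset[of "\<Union>\<BB>"]
      by (simp_all add: minimal_atomic_decomposition_iff)
    \<comment> \<open>An atom of \<open>\<CC>\<close> outside \<open>P \<union> Q \<union> R\<close> lies in both \<open>\<AA>\<close> and \<open>\<BB>\<close>.\<close>
    then have "\<Union>(?h \<CC>) \<subseteq> X \<inter> Y"
      using \<AA>(2) \<BB>(2) by blast
    moreover have "minimal_atomic_decomposition scale \<CC> U"
      using minimal_atomic_decomposition_Un(1)[OF \<AA>(1) QR] \<AA>(2) by simp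
    ultimately show ?thesis
      using minimal_atomic_decomposition_Diff[OF _ PQR sub XY(1)] sub by blast
  qed
  have "inj_on ?h (?f ` ?\<M> X \<inter> ?g ` ?\<M> Y)"
    by (rule inj_onI) (use common in blast)
  then have inter: "card (?f ` ?\<M> X \<inter> ?g ` ?\<M> Y) \<le> card (?\<M> (X \<inter> Y))"
    by (rule card_inj_on_le) (use common fin in auto)
  have "card (?\<M> X) + card (?\<M> Y) = card (?f ` ?\<M> X) + card (?g ` ?\<M> Y)"
    by (simp only: card_image[OF inj_f] card_image[OF inj_g])
  also have "\<dots> = card (?f ` ?\<M> X \<union> ?g ` ?\<M> Y) + card (?f ` ?\<M> X \<inter> ?g ` ?\<M> Y)"
    by (intro card_Un_Int finite_imageI fin)
  also have "\<dots> \<le> card (?\<M> U) + card (?\<M> (X \<inter> Y))"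
    using union inter by (rule add_mono)
  finally show ?thesis
    by (simp only: num_min_decomp_def)
qed

corollary num_min_decomp_mono:
  assumes "finite (UNIV :: 'a set)" "subspace X" "subspace U" "X \<subseteq> U"
  shows "num_min_decomp scale X \<le> num_min_decomp scale U"
  using num_min_decomp_supermodular[OF assms(1,2,2,3,4,4)] by simp

lemma dist_N_commute: "dist_N scale S T = dist_N scale T S"
  by (simp add: dist_N_def Int_commute)

text \<open>
  After cancellation the inequality compares \<open>S \<inter> U\<close> and \<open>U \<inter> T\<close> with \<open>U\<close> and \<open>S \<inter> T\<close>. Both
  intersections lie in \<open>U\<close>, and their own intersection lies in \<open>S \<inter> T\<close>.
\<close>

lemma dist_N_triangle:
  assumes "finite (UNIV :: 'a set)" "subspace S" "subspace T" "subspace U"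
  shows "dist_N scale S T \<le> dist_N scale S U + dist_N scale U T"
proof -
  have "num_min_decomp scale (S \<inter> U) + num_min_decomp scale (U \<inter> T)
      \<le> num_min_decomp scale U + num_min_decomp scale ((S \<inter> U) \<inter> (U \<inter> T))"
    using assms by (intro num_min_decomp_supermodular subspace_inter) auto
  moreover have "num_min_decomp scale ((S \<inter> U) \<inter> (U \<inter> T)) \<le> num_min_decomp scale (S \<inter> T)"
    using assms by (intro num_min_decomp_mono subspace_inter) auto
  ultimately show ?thesis by (simp add: dist_N_def)
qed

section \<open>Decoding\<close>

lemma dist_N_split_Int: "dist_N scale U S = dist_N scale S (S \<inter> U) + dist_N scale U (S \<inter> U)"
  by (simp add: dist_N_def Int_commute Int_left_commute Int_absorb)

lemma subspace_channel_output:
  assumes "atomic_operator_channel scale S \<AA> \<AA>' t B U"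
  shows "subspace U"
proof -
  have "finite \<AA>'" "\<And>A. A \<in> \<AA>' \<Longrightarrow> subspace A" "\<And>j. j \<in> {1..t} \<Longrightarrow> subspace (B j)"
    using assms subspace_atom
    by (auto simp: atomic_operator_channel_def redundant_atomic_decomposition_def
        atomic_decomposition_def intro: finite_subset)
  then have "subspace ((\<Sum>A\<in>\<AA>'. A) + (\<Sum>j = 1..t. B j))"
    by (intro subspace_set_plus subspace_sum_subspaces) auto
  then show ?thesis
    using assms by (simp add: atomic_operator_channel_def)
qed

lemma min_distance_le:
  assumes "X \<in> \<C>" "Y \<in> \<C>" "X \<noteq> Y"
  shows "min_distance scale \<C> \<le> ereal (real_of_int (dist_N scale X Y))"
  unfolding min_distance_def using assms by (intro INF_lower2[of "(X, Y)"]) auto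

lemma dist_N_less_if_within_half_min_distance:
  assumes "finite (UNIV :: 'a set)" "subspace_code scale \<C>" "subspace U"
    and "S \<in> \<C>" "T \<in> \<C>" "T \<noteq> S"
    and "ereal (real_of_int (2 * dist_N scale U S)) < min_distance scale \<C>"
  shows "dist_N scale U S < dist_N scale U T"
proof -
  have "ereal (real_of_int (2 * dist_N scale U S)) < ereal (real_of_int (dist_N scale S T))"
    using assms(4-7) min_distance_le[of S \<C> T] by (metis less_le_trans)
  then have "2 * dist_N scale U S < dist_N scale S T"
    by (simp only: less_ereal.simps of_int_less_iff)
  also have "\<dots> \<le> dist_N scale S U + dist_N scale U T"
    using assms by (intro dist_N_triangle) (auto simp: subspace_code_def)
  finally show ?thesis by (simp add: dist_N_commute[of S U])
qed

lemma min_distance_decoder_le: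
  assumes "finite \<C>" "min_distance_decoder scale \<C> dec" "subspace U" "T \<in> \<C>"
  shows "dec U \<in> \<C>" and "dist_N scale U (dec U) \<le> dist_N scale U T"
  using assms by (auto simp: min_distance_decoder_def)

end

theorem theorem4:
  fixes scale :: "'a::{field, finite} \<Rightarrow> 'b::ab_group_add \<Rightarrow> 'b"
    and Basis :: "'b set"
    and N q t :: nat
    and \<C> \<AA> \<AA>' :: "'b set set"
    and S S' U :: "'b set"
    and B :: "nat \<Rightarrow> 'b set"
  assumes "finite_dimensional_vector_space scale Basis"
    and "vector_space.dim scale (UNIV :: 'b set) = N"
    and "card (UNIV :: 'a set) = q"
    and "subspace_code scale \<C>"
    and "S \<in> \<C>"
    and "atomic_operator_channel scale S \<AA> \<AA>' t B U"
    and "S' = S \<inter> U"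
  shows "dist_N scale U S =
           dist_N scale S S' + dist_N scale U S'
       \<and> dist_N scale S S' + dist_N scale U S' =
           erasure_cost scale S S' + insertion_cost scale U S'
       \<and> (ereal (real_of_int (2 * dist_N scale U S)) < min_distance scale \<C>
           \<longrightarrow> (\<forall>T. is_arg_min (dist_N scale U) (\<lambda>X. X \<in> \<C>) T \<longleftrightarrow> T = S)
             \<and> (\<forall>dec. min_distance_decoder scale \<C> dec \<longrightarrow> dec U = S))"
proof -
  interpret finite_dimensional_vector_space scale Basis by fact
  have fin: "finite (UNIV :: 'a set)" by simp
  have U: "subspace U"
    using assms(6) by (rule subspace_channel_output)
  have "finite \<C>"
    by (rule finite_subset[OF subset_UNIV]) (simp add: Finite_Set.finite_set finite_UNIV_finite_field[OF fin])
  have split: "dist_N scale U S = dist_N scale S S' + dist_N scale U S'"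
    unfolding assms(7) by (rule dist_N_split_Int)
  have "(\<forall>T. is_arg_min (dist_N scale U) (\<lambda>X. X \<in> \<C>) T \<longleftrightarrow> T = S)
      \<and> (\<forall>dec. min_distance_decoder scale \<C> dec \<longrightarrow> dec U = S)"
    if close: "ereal (real_of_int (2 * dist_N scale U S)) < min_distance scale \<C>"
  proof -
    have less: "dist_N scale U S < dist_N scale U T" if "T \<in> \<C>" "T \<noteq> S" for T
      using dist_N_less_if_within_half_min_distance[OF fin assms(4) U assms(5) that close] .
    have "is_arg_min (dist_N scale U) (\<lambda>X. X \<in> \<C>) T \<longleftrightarrow> T = S" for T
      using less assms(5) unfolding is_arg_min_def by (metis less_asym less_irrefl)
    moreover have "dec U = S" if "min_distance_decoder scale \<C> dec" for dec
      using min_distance_decoder_le[OF \<open>finite \<C>\<close> that U assms(5)] less by (meson leD)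
    ultimately show ?thesis by blast
  qed
  then show ?thesis
    using split by (simp add: erasure_cost_def insertion_cost_def)
qed

end
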